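(* It is not true in general that a block of $kC_G(Q)$ remains a block of $kH$ for every subgroup $H$ with $C_G(Q)\le H\le N_G(Q,e)$, even if $Q$ is a Sylow $p$-subgroup of $G$. That is: for $p=3$ and $k$ an algebraically closed field of characteristic $3$, there exist a finite group $G$, a Sylow $3$-subgroup $Q$ of $G$ with $Q\cong 3_+^{1+2}$, a block $e$ of $kC_G(Q)$, and a subgroup $H$ of $G$ with $C_G(Q)\le H\le N_G(Q,e)$, such that $e$ is not a block of $kH$.
   Context: A block of $kG$ is a primitive idempotent of the center of $kG$. For a $p$-subgroup $Q$ of $G$ and a block $e$ of $kC_G(Q)$, $N_G(Q,e)$ is the subgroup of all $g\in N_G(Q)$ with $geg^{-1}=e$. $3_+^{1+2}$ is the extraspecial group of order $27$ and exponent $3$. *)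

theory Defs
  imports
    "HOL-Computational_Algebra.Computational_Algebra"
    "HOL-Algebra.Group_Action"
    "HOL-Algebra.Multiplicative_Group"
begin

section \<open>Finite groups\<close>

definition centralizer :: "('g, 'm) monoid_scheme \<Rightarrow> 'g set \<Rightarrow> 'g set" where
  "centralizer G Q = {g \<in> carrier G. \<forall>x\<in>Q. g \<otimes>\<^bsub>G\<^esub> x = x \<otimes>\<^bsub>G\<^esub> g}"

definition group_center :: "('g, 'm) monoid_scheme \<Rightarrow> 'g set" where
  "group_center G = centralizer G (carrier G)"

definition sylow_subgroup :: "nat \<Rightarrow> ('g, 'm) monoid_scheme \<Rightarrow> 'g set \<Rightarrow> bool" where
  "sylow_subgroup p G Q \<longleftrightarrow> subgroup Q G \<and> card Q = p ^ multiplicity p (order G)"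

text \<open>Since \<^const>\<open>group.ord\<close> is \<open>0\<close> on elements of infinite order, the exponent of a group
  in which no positive power annihilates all elements is \<open>0\<close>.\<close>

definition group_exponent :: "('g, 'm) monoid_scheme \<Rightarrow> nat" where
  "group_exponent G = Lcm (group.ord G ` carrier G)"

definition elementary_abelian :: "nat \<Rightarrow> ('g, 'm) monoid_scheme \<Rightarrow> bool" where
  "elementary_abelian p G \<longleftrightarrow> comm_group G \<and> (\<forall>x\<in>carrier G. x [^]\<^bsub>G\<^esub> p = \<one>\<^bsub>G\<^esub>)"

definition extraspecial :: "nat \<Rightarrow> ('g, 'm) monoid_scheme \<Rightarrow> bool" where
  "extraspecial p G \<longleftrightarrow> prime p \<and> group G \<and> (\<exists>n. order G = p ^ n) \<and>
     card (group_center G) = p \<and>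
     elementary_abelian p (G Mod group_center G) \<and>
     carrier (G Mod group_center G) \<noteq> {\<one>\<^bsub>G Mod group_center G\<^esub>}"

text \<open>The isomorphism type \<open>3\<^sub>+\<^sup>1\<^sup>+\<^sup>2\<close>, of which there is exactly one: the
  extraspecial group of order 27 and exponent 3.\<close>

definition is_three_plus_one_plus_two :: "('g, 'm) monoid_scheme \<Rightarrow> bool" where
  "is_three_plus_one_plus_two G \<longleftrightarrow> extraspecial 3 G \<and> order G = 27 \<and> group_exponent G = 3"

section \<open>Primitive idempotents of a ring\<close>

definition ring_center :: "('a, 'm) ring_scheme \<Rightarrow> ('a, 'm) ring_scheme" where
  "ring_center R = R\<lparr>carrier := {z \<in> carrier R. \<forall>x\<in>carrier R. z \<otimes>\<^bsub>R\<^esub> x = x \<otimes>\<^bsub>R\<^esub> z}\<rparr>"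

definition ring_idempotents :: "('a, 'm) ring_scheme \<Rightarrow> 'a set" where
  "ring_idempotents R = {i \<in> carrier R. i \<otimes>\<^bsub>R\<^esub> i = i}"

definition primitive_idempotent :: "('a, 'm) ring_scheme \<Rightarrow> 'a \<Rightarrow> bool" where
  "primitive_idempotent R i \<longleftrightarrow> i \<in> ring_idempotents R \<and> i \<noteq> \<zero>\<^bsub>R\<^esub> \<and>
     (\<forall>a\<in>ring_idempotents R. \<forall>b\<in>ring_idempotents R.
        a \<otimes>\<^bsub>R\<^esub> b = \<zero>\<^bsub>R\<^esub> \<and> b \<otimes>\<^bsub>R\<^esub> a = \<zero>\<^bsub>R\<^esub> \<and> a \<oplus>\<^bsub>R\<^esub> b = i
        \<longrightarrow> a = \<zero>\<^bsub>R\<^esub> \<or> b = \<zero>\<^bsub>R\<^esub>)"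

section \<open>Group algebras and blocks\<close>

text \<open>Elements of \<open>kG\<close> are the finitely supported coefficient functions, extended by \<open>0\<close> outside
  the carrier of \<open>G\<close>. With this convention, for a subgroup \<open>H\<close> of \<open>G\<close>, the algebra \<open>kH\<close>, which is
  \<open>group_algebra (G\<lparr>carrier := H\<rparr>)\<close>, is literally a subset of \<open>kG\<close>.\<close>

definition group_algebra :: "('g, 'm) monoid_scheme \<Rightarrow> ('g \<Rightarrow> 'k::field) ring" where
  "group_algebra G =
     \<lparr>carrier = {a. finite {x. a x \<noteq> 0} \<and> {x. a x \<noteq> 0} \<subseteq> carrier G},
      mult = (\<lambda>a b x. if x \<in> carrier G
                then \<Sum>y | y \<in> carrier G \<and> a y \<noteq> 0. a y * b (inv\<^bsub>G\<^esub> y \<otimes>\<^bsub>G\<^esub> x) else 0),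
      one = (\<lambda>x. if x = \<one>\<^bsub>G\<^esub> then 1 else 0),
      zero = (\<lambda>x. 0),
      add = (\<lambda>a b x. a x + b x)\<rparr>"

definition group_element :: "'g \<Rightarrow> 'g \<Rightarrow> 'k::field" where
  "group_element g = (\<lambda>x. if x = g then 1 else 0)"

definition is_block :: "('g, 'm) monoid_scheme \<Rightarrow> ('g \<Rightarrow> 'k::field) \<Rightarrow> bool" where
  "is_block G e \<longleftrightarrow> primitive_idempotent (ring_center (group_algebra G)) e"

text \<open>\<open>N\<^sub>G(Q,e)\<close>; the conjugate \<open>geg\<^sup>-\<^sup>1\<close> is formed in \<open>kG\<close>.\<close>

definition block_normalizer ::
    "('g, 'm) monoid_scheme \<Rightarrow> 'g set \<Rightarrow> ('g \<Rightarrow> 'k::field) \<Rightarrow> 'g set" where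
  "block_normalizer G Q e = {g \<in> normalizer G Q.
     group_element g \<otimes>\<^bsub>group_algebra G\<^esub> e \<otimes>\<^bsub>group_algebra G\<^esub> group_element (inv\<^bsub>G\<^esub> g) = e}"

end

theory Submission
  imports Defs "HOL-Library.Numeral_Type" "HOL-Library.Countable"
begin

text \<open>
  If \<open>H\<close> contains \<open>Q\<close>, then every central idempotent of \<open>kH\<close> lies in \<open>kC\<^sub>G(Q)\<close>, because \<open>Q\<close> is
  a normal \<open>p\<close>-subgroup of \<open>H\<close>. A counterexample therefore needs a subgroup \<open>H\<close> that does not
  contain \<open>Q\<close> and in which some \<open>p'\<close>-elements outside \<open>C\<^sub>G(Q)\<close> are free to create new idempotents.

  Let \<open>Q\<close> be the Heisenberg group over the field with three elements, which is \<open>3\<^sub>+\<^sup>1\<^sup>+\<^sup>2\<close>, and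
  let \<open>t\<close> be the involutory automorphism that inverts \<open>Q/Z(Q)\<close> and fixes \<open>Z(Q)\<close>. In the
  semidirect product \<open>G\<close> of order 54, \<open>Q\<close> is a normal Sylow 3-subgroup and \<open>C\<^sub>G(Q) = Z(Q)\<close> has
  order 3 (\<open>centralizer_heisenberg\<close>). Take \<open>e = 1\<close>, which every element of \<open>G\<close> fixes.
  In characteristic 3 the algebra of a group of order 3 is local, so \<open>1\<close> is a block of
  \<open>kC\<^sub>G(Q)\<close> (\<open>one_is_block_order_3\<close>). But \<open>H = Z(Q) \<times> \<langle>t\<rangle>\<close> is abelian of order 6, and
  \<open>t\<close> becomes a central involution there, so \<open>1 = (1 + t)/2 + (1 - t)/2\<close> is a nontrivial
  decomposition in \<open>kH\<close> (\<open>one_not_block_if_central_involution\<close>).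
\<close>

section \<open>The identity of a group algebra as a candidate block\<close>

lemma group_algebra_one_subgroup:
  "\<one>\<^bsub>group_algebra (G\<lparr>carrier := H\<rparr>)\<^esub> = \<one>\<^bsub>group_algebra G\<^esub>"
  by (simp add: group_algebra_def)

lemma group_algebra_eqI:
  assumes "\<And>x. x \<in> carrier G \<Longrightarrow> a x = b x"
    and "a \<in> carrier (group_algebra G)" and "b \<in> carrier (group_algebra G)"
  shows "a = b"
proof
  fix x
  show "a x = b x"
  proof (cases "x \<in> carrier G")
    case False
    then have "a x = 0" "b x = 0"
      using assms(2,3) by (auto simp: group_algebra_def)
    then show ?thesis
      by simp
  qed (rule assms(1))
qed

lemma group_algebra_mult_apply:
  fixes a b :: "'g \<Rightarrow> 'k::field"
  assumes "finite (carrier G)" and "x \<in> carrier G"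
  shows "(a \<otimes>\<^bsub>group_algebra G\<^esub> b) x = (\<Sum>y\<in>carrier G. a y * b (inv\<^bsub>G\<^esub> y \<otimes>\<^bsub>G\<^esub> x))"
proof -
  have "(\<Sum>y | y \<in> carrier G \<and> a y \<noteq> 0. a y * b (inv\<^bsub>G\<^esub> y \<otimes>\<^bsub>G\<^esub> x))
      = (\<Sum>y\<in>carrier G. a y * b (inv\<^bsub>G\<^esub> y \<otimes>\<^bsub>G\<^esub> x))"
    using assms(1) by (intro sum.mono_neutral_left) auto
  then show ?thesis
    using assms(2) by (simp add: group_algebra_def)
qed

lemma group_algebra_mult_closed:
  fixes a b :: "'g \<Rightarrow> 'k::field"
  assumes "finite (carrier G)"
  shows "a \<otimes>\<^bsub>group_algebra G\<^esub> b \<in> carrier (group_algebra G)"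
proof -
  have "{x. (a \<otimes>\<^bsub>group_algebra G\<^esub> b) x \<noteq> 0} \<subseteq> carrier G"
    by (auto simp: group_algebra_def split: if_splits)
  then show ?thesis
    using finite_subset[OF _ assms] by (simp add: group_algebra_def)
qed

lemma ring_center_simps:
  "(\<otimes>\<^bsub>ring_center R\<^esub>) = (\<otimes>\<^bsub>R\<^esub>)" "(\<oplus>\<^bsub>ring_center R\<^esub>) = (\<oplus>\<^bsub>R\<^esub>)" "\<zero>\<^bsub>ring_center R\<^esub> = \<zero>\<^bsub>R\<^esub>"
  "carrier (ring_center R) = {z \<in> carrier R. \<forall>x\<in>carrier R. z \<otimes>\<^bsub>R\<^esub> x = x \<otimes>\<^bsub>R\<^esub> z}"
  by (simp_all add: ring_center_def)

context group
begin

lemma group_element_mult: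
  fixes b :: "'a \<Rightarrow> 'k::field"
  assumes "finite (carrier G)" "g \<in> carrier G" "x \<in> carrier G"
  shows "(group_element g \<otimes>\<^bsub>group_algebra G\<^esub> b) x = b (inv g \<otimes> x)"
proof -
  have "(\<Sum>y\<in>carrier G. group_element g y * b (inv y \<otimes> x))
      = (\<Sum>y\<in>{g}. group_element g y * b (inv y \<otimes> x))"
    using assms by (intro sum.mono_neutral_right) (auto simp: group_element_def)
  then show ?thesis
    using assms by (simp add: group_algebra_mult_apply group_element_def)
qed

text \<open>The function in the statement is the element \<open>c + d t\<close> of the group algebra. Since
  \<open>t\<close> is its own inverse, only the summands \<open>y = \<one>\<close> and \<open>y = t\<close> (respectively \<open>y = x\<close> and
  \<open>y = x t\<close>) of the convolution survive.\<close>

lemma group_algebra_involution_mult: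
  fixes b :: "'a \<Rightarrow> 'k::field"
  assumes fin: "finite (carrier G)" and t: "t \<in> carrier G" "t \<noteq> \<one>" "t \<otimes> t = \<one>"
    and x: "x \<in> carrier G"
  shows "((\<lambda>y. if y = \<one> then c else if y = t then d else 0) \<otimes>\<^bsub>group_algebra G\<^esub> b) x
           = c * b x + d * b (t \<otimes> x)" (is "(?a \<otimes>\<^bsub>group_algebra G\<^esub> b) x = _")
    and "(b \<otimes>\<^bsub>group_algebra G\<^esub> (\<lambda>y. if y = \<one> then c else if y = t then d else 0)) x
           = c * b x + d * b (x \<otimes> t)"
proof -
  have inv_t: "inv t = t"
    using t inv_equality by blast
  have "(\<Sum>y\<in>carrier G. ?a y * b (inv y \<otimes> x)) = (\<Sum>y\<in>{\<one>, t}. ?a y * b (inv y \<otimes> x))"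
    using fin t by (intro sum.mono_neutral_right) auto
  then show "(?a \<otimes>\<^bsub>group_algebra G\<^esub> b) x = c * b x + d * b (t \<otimes> x)"
    using fin t x inv_t by (auto simp: group_algebra_mult_apply)
  have xt: "x \<noteq> x \<otimes> t"
    using t x by simp
  have inv_xt: "inv (x \<otimes> t) \<otimes> x = t"
    using t x inv_t by (simp add: inv_mult_group m_assoc)
  have "inv y \<otimes> x = \<one> \<Longrightarrow> y = x" if "y \<in> carrier G" for y
    using that x by (simp add: inv_solve_left')
  moreover have "inv y \<otimes> x = t \<Longrightarrow> y = x \<otimes> t" if "y \<in> carrier G" for y
    using that x t by (simp add: inv_solve_left' m_assoc)
  ultimately have "(\<Sum>y\<in>carrier G. b y * ?a (inv y \<otimes> x))
      = (\<Sum>y\<in>{x, x \<otimes> t}. b y * ?a (inv y \<otimes> x))"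
    using fin t x by (intro sum.mono_neutral_right) auto
  also have "\<dots> = b x * c + b (x \<otimes> t) * d"
    using x t xt inv_xt by simp
  finally show "(b \<otimes>\<^bsub>group_algebra G\<^esub> ?a) x = c * b x + d * b (x \<otimes> t)"
    using fin x by (simp add: group_algebra_mult_apply mult.commute)
qed

text \<open>The decomposition is \<open>1 = (1 + t)/2 + (1 - t)/2\<close>: the summands are idempotents because
  \<open>t\<^sup>2 = 1\<close>, orthogonal because \<open>(1 + t)(1 - t) = 0\<close>, and central because \<open>t\<close> is.\<close>

lemma one_not_block_if_central_involution:
  assumes fin: "finite (carrier G)" and t: "t \<in> carrier G" "t \<noteq> \<one>" "t \<otimes> t = \<one>"
    and central: "\<And>x. x \<in> carrier G \<Longrightarrow> t \<otimes> x = x \<otimes> t"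
    and two: "(2::'k::field) \<noteq> 0"
  shows "\<not> is_block G (\<one>\<^bsub>group_algebra G\<^esub> :: 'a \<Rightarrow> 'k)"
proof
  let ?A = "group_algebra G :: ('a \<Rightarrow> 'k) ring"
  \<comment> \<open>the element \<open>c + d t\<close>; these form a subalgebra isomorphic to that of a group of order 2\<close>
  define w where "w c d = (\<lambda>y. if y = \<one> then c else if y = t then d else (0::'k))" for c d
  note mult = group_algebra_involution_mult[where 'k = 'k, OF fin t, folded w_def]
  have w_closed: "w c d \<in> carrier ?A" for c d
  proof -
    have "{x. w c d x \<noteq> 0} \<subseteq> {\<one>, t}"
      by (auto simp: w_def)
    then show ?thesis
      using t(1) finite_subset[of _ "{\<one>, t}"] by (auto simp: group_algebra_def)
  qed
  have w_central: "w c d \<in> carrier (ring_center ?A)" for c d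
  proof -
    have "w c d \<otimes>\<^bsub>?A\<^esub> b = b \<otimes>\<^bsub>?A\<^esub> w c d" for b :: "'a \<Rightarrow> 'k"
    proof (rule group_algebra_eqI[where G = G])
      fix x assume "x \<in> carrier G"
      then show "(w c d \<otimes>\<^bsub>?A\<^esub> b) x = (b \<otimes>\<^bsub>?A\<^esub> w c d) x"
        by (simp only: mult central)
    qed (simp_all add: group_algebra_mult_closed fin)
    then show ?thesis
      by (simp add: ring_center_def w_closed)
  qed
  have t_eq_one: "t \<otimes> x = \<one> \<longleftrightarrow> x = t" if "x \<in> carrier G" for x
    using t that Units_l_cancel[of t x t] by simp
  have t_eq_t: "t \<otimes> x = t \<longleftrightarrow> x = \<one>" if "x \<in> carrier G" for x
    using t that by simp
  have w_mult: "w c d \<otimes>\<^bsub>?A\<^esub> w c' d' = w (c * c' + d * d') (c * d' + d * c')" for c d c' d'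
  proof (rule group_algebra_eqI[where G = G])
    fix x assume "x \<in> carrier G"
    then show "(w c d \<otimes>\<^bsub>?A\<^esub> w c' d') x = w (c * c' + d * d') (c * d' + d * c') x"
      using t(2) by (auto simp: mult(1)) (auto simp: w_def t_eq_one t_eq_t)
  qed (simp_all add: w_closed group_algebra_mult_closed fin)
  obtain h :: 'k where h: "h + h = 1"
  proof
    show "1 / 2 + 1 / 2 = (1::'k)"
      using two by (simp flip: add_divide_distrib)
  qed
  have "2 * (h * h) = h * (h + h)"
    by (simp add: algebra_simps)
  then have hh: "2 * (h * h) = h"
    by (simp only: h mult_1_right)
  have "w h h \<otimes>\<^bsub>?A\<^esub> w h h = w h h" "w h (- h) \<otimes>\<^bsub>?A\<^esub> w h (- h) = w h (- h)"
    unfolding w_mult by (simp_all add: hh)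
  then have idem: "w h h \<in> ring_idempotents (ring_center ?A)"
    "w h (- h) \<in> ring_idempotents (ring_center ?A)"
    using w_central by (simp_all add: ring_idempotents_def ring_center_simps(1))
  have w_zero: "w 0 0 = \<zero>\<^bsub>?A\<^esub>"
    by (auto simp: w_def group_algebra_def)
  have orth: "w h h \<otimes>\<^bsub>?A\<^esub> w h (- h) = \<zero>\<^bsub>?A\<^esub>" "w h (- h) \<otimes>\<^bsub>?A\<^esub> w h h = \<zero>\<^bsub>?A\<^esub>"
    by (simp_all add: w_mult flip: w_zero)
  have sum: "w h h \<oplus>\<^bsub>?A\<^esub> w h (- h) = \<one>\<^bsub>?A\<^esub>"
    using h t(2) by (auto simp: w_def group_algebra_def fun_eq_iff)
  assume "is_block G (\<one>\<^bsub>?A\<^esub>)"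
  then have "w h h = \<zero>\<^bsub>?A\<^esub> \<or> w h (- h) = \<zero>\<^bsub>?A\<^esub>"
    using idem orth sum unfolding is_block_def primitive_idempotent_def ring_center_simps
    by blast
  moreover have "w h d \<noteq> \<zero>\<^bsub>?A\<^esub>" for d
  proof
    assume "w h d = \<zero>\<^bsub>?A\<^esub>"
    then have "w h d \<one> = 0"
      by (simp add: group_algebra_def)
    then show False
      using h by (simp add: w_def)
  qed
  ultimately show False
    by blast
qed

text \<open>Cubing in characteristic 3 is additive on the commutative algebra of a group of order 3,
  and every group element cubes to \<open>1\<close>. Hence \<open>a = a\<^sup>2\<close> implies that \<open>a = a\<^sup>3\<close> is a scalar,
  and a scalar idempotent is \<open>0\<close> or \<open>1\<close>.\<close>

lemma group_algebra_idempotent_order_3: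
  assumes ord3: "order G = 3" and char3: "CHAR('k::field) = 3"
    and a: "a \<in> ring_idempotents (group_algebra G :: ('a \<Rightarrow> 'k) ring)"
  shows "a = \<zero>\<^bsub>group_algebra G\<^esub> \<or> a = \<one>\<^bsub>group_algebra G\<^esub>"
proof -
  have fin: "finite (carrier G)"
    using ord3 order_gt_0_iff_finite by simp
  have "carrier G \<noteq> {\<one>}"
    using ord3 by (auto simp: order_def)
  then obtain z where z: "z \<in> carrier G" "z \<noteq> \<one>"
    using one_closed by blast
  have "z [^] (3::nat) = \<one>"
    using pow_order_eq_1[OF z(1)] ord3 by simp
  then have zzz: "z \<otimes> z \<otimes> z = \<one>"
    using z(1) by (simp add: numeral_3_eq_3)
  have zz1: "z \<otimes> z \<noteq> \<one>"
    using zzz z by auto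
  have zzz': "z \<otimes> (z \<otimes> z) = \<one>"
    using zzz z(1) by (simp add: m_assoc)
  have zzzz: "z \<otimes> z \<otimes> (z \<otimes> z) = z"
    using zzz z(1) by (simp flip: m_assoc)
  have zz: "z \<otimes> z \<noteq> z"
    using z by simp
  have "card {\<one>, z, z \<otimes> z} = card (carrier G)"
    using ord3 z(2) zz1 zz by (auto simp: order_def)
  then have carrier: "carrier G = {\<one>, z, z \<otimes> z}"
    using card_subset_eq[OF fin, of "{\<one>, z, z \<otimes> z}"] z by auto
  have invs: "inv z = z \<otimes> z" "inv (z \<otimes> z) = z"
    using zzz zzz' z(1) by (auto intro: inv_equality)
  define a0 a1 a2 where "a0 = a \<one>" and "a1 = a z" and "a2 = a (z \<otimes> z)"
  have aa: "a \<otimes>\<^bsub>group_algebra G\<^esub> a = a" and ac: "a \<in> carrier (group_algebra G)"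
    using a by (auto simp: ring_idempotents_def)
  have coeff: "a x = a \<one> * a x + a z * a (z \<otimes> z \<otimes> x) + a (z \<otimes> z) * a (z \<otimes> x)"
    if x: "x \<in> carrier G" for x
  proof -
    have "a x = (\<Sum>y\<in>carrier G. a y * a (inv y \<otimes> x))"
      using group_algebra_mult_apply[OF fin x, of a a] aa by simp
    also have "\<dots> = (\<Sum>y\<in>{\<one>, z, z \<otimes> z}. a y * a (inv y \<otimes> x))"
      by (simp only: carrier)
    finally show ?thesis
      using z zz zz1 zz[symmetric] zz1[symmetric] z(2)[symmetric] x invs by (simp add: add.assoc)
  qed
  have e0: "a0 = a0 * a0 + a1 * a2 + a2 * a1"
    using coeff[of \<one>] z by (simp add: a0_def a1_def a2_def)
  have e1: "a1 = a0 * a1 + a1 * a0 + a2 * a2"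
    using coeff[of z] z zzz by (simp add: a0_def a1_def a2_def)
  have e2: "a2 = a0 * a2 + a1 * a1 + a2 * a0"
    using coeff[of "z \<otimes> z"] z zzz' zzzz by (simp add: a0_def a1_def a2_def)
  have three: "(3::'k) = 0"
    using of_nat_CHAR[where 'a = 'k] char3 by simp
  \<comment> \<open>the coefficients of \<open>a\<^sup>3 = a a\<^sup>2\<close> at \<open>z\<close> and \<open>z\<^sup>2\<close>, which are multiples of 3\<close>
  have "a1 = a0 * (a0 * a1 + a1 * a0 + a2 * a2) + a1 * (a0 * a0 + a1 * a2 + a2 * a1)
      + a2 * (a0 * a2 + a1 * a1 + a2 * a0)"
    by (simp only: e0[symmetric] e1[symmetric] e2[symmetric])
  also have "\<dots> = 3 * (a0 * a0 * a1 + a0 * a2 * a2 + a1 * a1 * a2)"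
    by (simp add: algebra_simps)
  finally have a1: "a1 = 0"
    using three by simp
  have "a2 = a0 * (a0 * a2 + a1 * a1 + a2 * a0) + a1 * (a0 * a1 + a1 * a0 + a2 * a2)
      + a2 * (a0 * a0 + a1 * a2 + a2 * a1)"
    by (simp only: e0[symmetric] e1[symmetric] e2[symmetric])
  also have "\<dots> = 3 * (a0 * a0 * a2 + a0 * a1 * a1 + a1 * a2 * a2)"
    by (simp add: algebra_simps)
  finally have a2: "a2 = 0"
    using three by simp
  have "a0 * (a0 - 1) = 0"
    using e0 a1 by (simp add: algebra_simps)
  then have a0: "a0 = 0 \<or> a0 = 1"
    by simp
  have one: "\<one>\<^bsub>group_algebra G\<^esub> \<in> carrier (group_algebra G :: ('a \<Rightarrow> 'k) ring)"
    by (auto simp: group_algebra_def)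
  have zero: "\<zero>\<^bsub>group_algebra G\<^esub> \<in> carrier (group_algebra G :: ('a \<Rightarrow> 'k) ring)"
    by (auto simp: group_algebra_def)
  show ?thesis
    using a0
  proof
    assume "a0 = 0"
    then have "a = \<zero>\<^bsub>group_algebra G\<^esub>"
      using a1 a2 carrier
      by (intro group_algebra_eqI[OF _ ac zero])
        (auto simp: a0_def a1_def a2_def group_algebra_def)
    then show ?thesis ..
  next
    assume "a0 = 1"
    then have "a = \<one>\<^bsub>group_algebra G\<^esub>"
      using a1 a2 carrier z(2) zz1
      by (intro group_algebra_eqI[OF _ ac one])
        (auto simp: a0_def a1_def a2_def group_algebra_def)
    then show ?thesis ..
  qed
qed

text \<open>Decompositions of \<open>1\<close> in the center are ruled out by the idempotents of the whole algebra.\<close>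

lemma one_is_block_order_3:
  assumes ord3: "order G = 3" and char3: "CHAR('k::field) = 3"
  shows "is_block G (\<one>\<^bsub>group_algebra G\<^esub> :: 'a \<Rightarrow> 'k)"
proof -
  let ?A = "group_algebra G :: ('a \<Rightarrow> 'k) ring"
  have fin: "finite (carrier G)"
    using ord3 order_gt_0_iff_finite by simp
  have one_closed: "\<one>\<^bsub>?A\<^esub> \<in> carrier ?A"
    by (auto simp: group_algebra_def)
  have one_eq: "\<one>\<^bsub>?A\<^esub> = group_element \<one>"
    by (simp add: group_algebra_def group_element_def)
  have one_left: "\<one>\<^bsub>?A\<^esub> \<otimes>\<^bsub>?A\<^esub> b = b" if "b \<in> carrier ?A" for b
    using that unfolding one_eq
    by (intro group_algebra_eqI[where G = G])
      (simp_all add: group_element_mult fin group_algebra_mult_closed)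
  have one_right: "b \<otimes>\<^bsub>?A\<^esub> \<one>\<^bsub>?A\<^esub> = b" if b: "b \<in> carrier ?A" for b
  proof (rule group_algebra_eqI[OF _ _ b])
    fix x assume x: "x \<in> carrier G"
    have "inv y \<otimes> x = \<one> \<longleftrightarrow> y = x" if "y \<in> carrier G" for y
      using that x by (auto simp: inv_solve_left')
    then have "(\<Sum>y\<in>carrier G. b y * (\<one>\<^bsub>?A\<^esub>) (inv y \<otimes> x)) = (\<Sum>y\<in>carrier G. if y = x then b y else 0)"
      by (intro sum.cong) (auto simp: group_algebra_def)
    then show "(b \<otimes>\<^bsub>?A\<^esub> \<one>\<^bsub>?A\<^esub>) x = b x"
      using fin x by (simp add: group_algebra_mult_apply)
  qed (simp add: group_algebra_mult_closed fin)
  have one_idem: "\<one>\<^bsub>?A\<^esub> \<in> ring_idempotents (ring_center ?A)"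
    using one_closed one_left one_right by (simp add: ring_idempotents_def ring_center_def)
  have "\<one>\<^bsub>?A\<^esub> \<noteq> \<zero>\<^bsub>?A\<^esub>"
    by (auto simp: group_algebra_def fun_eq_iff)
  moreover have "a = \<zero>\<^bsub>?A\<^esub> \<or> b = \<zero>\<^bsub>?A\<^esub>"
    if "a \<in> ring_idempotents (ring_center ?A)" "b \<in> ring_idempotents (ring_center ?A)"
      "a \<otimes>\<^bsub>?A\<^esub> b = \<zero>\<^bsub>?A\<^esub>" for a b
  proof -
    have a: "a \<in> ring_idempotents ?A" and b: "b \<in> carrier ?A"
      using that unfolding ring_idempotents_def ring_center_simps by blast+
    have "b = \<zero>\<^bsub>?A\<^esub>" if "a = \<one>\<^bsub>?A\<^esub>"
      using one_left[OF b] \<open>a \<otimes>\<^bsub>?A\<^esub> b = \<zero>\<^bsub>?A\<^esub>\<close> that by simp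
    then show ?thesis
      using group_algebra_idempotent_order_3[OF ord3 char3 a] by blast
  qed
  ultimately show ?thesis
    using one_idem unfolding is_block_def primitive_idempotent_def ring_center_simps
    by blast
qed

text \<open>The identity of \<open>kG\<close> is fixed under conjugation, so only the condition on \<open>Q\<close> remains.\<close>

lemma block_normalizer_one:
  assumes fin: "finite (carrier G)"
  shows "block_normalizer G Q (\<one>\<^bsub>group_algebra G\<^esub> :: 'a \<Rightarrow> 'k::field) = normalizer G Q"
proof -
  let ?A = "group_algebra G :: ('a \<Rightarrow> 'k) ring"
  have closed: "group_element g \<in> carrier ?A" if "g \<in> carrier G" for g
    using that by (auto simp: group_algebra_def group_element_def)
  have one_eq: "\<one>\<^bsub>?A\<^esub> = group_element \<one>"
    by (simp add: group_algebra_def group_element_def)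
  have mult: "group_element g \<otimes>\<^bsub>?A\<^esub> group_element h = group_element (g \<otimes> h)"
    if gh: "g \<in> carrier G" "h \<in> carrier G" for g h
  proof (rule group_algebra_eqI[where G = G])
    fix x assume x: "x \<in> carrier G"
    then have "inv g \<otimes> x = h \<longleftrightarrow> x = g \<otimes> h"
      using gh inv_solve_left' by blast
    then show "(group_element g \<otimes>\<^bsub>?A\<^esub> group_element h) x = group_element (g \<otimes> h) x"
      using gh x fin by (simp add: group_element_mult) (simp add: group_element_def)
  qed (simp_all add: closed gh group_algebra_mult_closed fin)
  have "group_element g \<otimes>\<^bsub>?A\<^esub> \<one>\<^bsub>?A\<^esub> \<otimes>\<^bsub>?A\<^esub> group_element (inv g) = \<one>\<^bsub>?A\<^esub>"
    if "g \<in> carrier G" for g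
    using that by (simp add: one_eq mult)
  moreover have "normalizer G Q \<subseteq> carrier G"
    by (auto simp: normalizer_def stabilizer_def)
  ultimately show ?thesis
    by (auto simp: block_normalizer_def)
qed

end

section \<open>Normalizers, exponents and quotients\<close>

context group
begin

lemma normalizer_normal:
  assumes "N \<lhd> G"
  shows "normalizer G N = carrier G"
proof -
  interpret normal N G
    by (rule assms)
  have "g <# N #> inv g = N" if "g \<in> carrier G" for g
    using that coset_eq subset by (simp add: coset_mult_assoc flip: coset_eq)
  then show ?thesis
    using subset by (auto simp: normalizer_def stabilizer_def)
qed

lemma group_exponent_prime:
  assumes p: "prime p" and pow: "\<And>x. x \<in> carrier G \<Longrightarrow> x [^] p = \<one>"
    and nontrivial: "carrier G \<noteq> {\<one>}"
  shows "group_exponent G = p"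
proof (rule dvd_antisym)
  show "group_exponent G dvd p"
    using pow by (auto simp: group_exponent_def pow_eq_id intro!: Lcm_least)
  obtain x where x: "x \<in> carrier G" "x \<noteq> \<one>"
    using nontrivial one_closed by blast
  then have "ord x dvd p" "ord x \<noteq> 1"
    using pow pow_eq_id ord_eq_1 by auto
  then have "ord x = p"
    using p unfolding prime_nat_iff by blast
  then show "p dvd group_exponent G"
    using x(1) by (auto simp: group_exponent_def)
qed

lemma elementary_abelian_Mod:
  assumes N: "N \<lhd> G"
    and comm: "\<And>x y. \<lbrakk>x \<in> carrier G; y \<in> carrier G\<rbrakk> \<Longrightarrow> \<exists>z\<in>N. x \<otimes> y = z \<otimes> (y \<otimes> x)"
    and pow: "\<And>x. x \<in> carrier G \<Longrightarrow> x [^] p = \<one>"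
  shows "elementary_abelian p (G Mod N)"
proof -
  interpret N: normal N G
    by (rule N)
  interpret Q: group "G Mod N"
    by (rule N.factorgroup_is_group)
  have "N #> (x \<otimes> y) = N #> (y \<otimes> x)" if xy: "x \<in> carrier G" "y \<in> carrier G" for x y
  proof -
    obtain z where z: "z \<in> N" "x \<otimes> y = z \<otimes> (y \<otimes> x)"
      using comm xy by blast
    then have "N #> (x \<otimes> y) = N #> z #> (y \<otimes> x)"
      using xy N.subset by (auto simp: coset_mult_assoc)
    also have "N #> z = N"
      using z(1) N.subset coset_join2 N.subgroup_axioms by blast
    finally show ?thesis .
  qed
  then have "comm_group (G Mod N)"
    by (intro Q.group_comm_groupI) (auto simp: carrier_FactGroup N.rcos_sum)
  moreover have "X [^]\<^bsub>G Mod N\<^esub> p = \<one>\<^bsub>G Mod N\<^esub>" if X: "X \<in> carrier (G Mod N)" for X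
  proof -
    obtain x where x: "x \<in> carrier G" "X = N #> x"
      using X unfolding carrier_FactGroup by blast
    have "X [^]\<^bsub>G Mod N\<^esub> p = N #> (x [^] p)"
      using hom_nat_pow[OF N.r_coset_hom_Mod x(1) is_group Q.is_group] x(2) by simp
    then show ?thesis
      using pow x(1) N.subset by simp
  qed
  ultimately show ?thesis
    by (simp add: elementary_abelian_def)
qed

lemma Mod_nontrivial:
  assumes N: "N \<lhd> G" and x: "x \<in> carrier G" "x \<notin> N"
  shows "carrier (G Mod N) \<noteq> {\<one>\<^bsub>G Mod N\<^esub>}"
proof
  assume "carrier (G Mod N) = {\<one>\<^bsub>G Mod N\<^esub>}"
  then have "N #> x = N"
    using x(1) by (auto simp: carrier_FactGroup)
  then show False
    using rcos_self[OF x(1) normal_imp_subgroup[OF N]] x(2) by simp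
qed

end

section \<open>The Heisenberg group modulo 3 extended by a sign\<close>

lemma mod_3_cases: "(x::3) = 0 \<or> x = 1 \<or> x = -1"
proof -
  have "card {0::3, 1, -1} = CARD(3)"
    by simp
  then have "{0::3, 1, -1} = UNIV"
    by (intro card_subset_eq) simp_all
  then show ?thesis
    by blast
qed

lemma mod_3_triple: "3 * (x::3) = 0"
  using mod_3_cases[of x] by auto

lemma mod_3_square_eq_1: "(x::3) * x = 1 \<longleftrightarrow> x = 1 \<or> x = -1"
  using mod_3_cases[of x] by auto

text \<open>The tuple \<open>(a, b, c, u)\<close> stands for the product of the unitriangular \<open>3 \<times> 3\<close> matrix with
  entries \<open>a\<close>, \<open>b\<close> above the diagonal and \<open>c\<close> in the corner, and the power of \<open>t\<close> acting on \<open>Q/Z(Q)\<close>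
  as the scalar \<open>u\<close>, where \<open>u\<close> is \<open>1\<close> or \<open>-1\<close>. Writing the action as multiplication in the
  ring of integers modulo 3 reduces the group axioms to polynomial identities with \<open>u\<^sup>2 = 1\<close>.\<close>

definition elt :: "3 \<Rightarrow> 3 \<Rightarrow> 3 \<Rightarrow> 3 \<Rightarrow> nat" where
  "elt a b c u = to_nat (a, b, c, u)"

definition signed_heisenberg :: "nat monoid" where
  "signed_heisenberg =
     \<lparr>carrier = {elt a b c u | a b c u. u * u = 1},
      mult = (\<lambda>m n. case (from_nat m, from_nat n) of ((a, b, c, u), (a', b', c', u')) \<Rightarrow>
        elt (a + u * a') (b + u * b') (c + c' + a * u * b') (u * u')),
      one = elt 0 0 0 1\<rparr>"

definition heisenberg :: "nat set" where
  "heisenberg = {elt a b c 1 | a b c. True}"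

definition heisenberg_center :: "nat set" where
  "heisenberg_center = {elt 0 0 c 1 | c. True}"

definition signed_center :: "nat set" where
  "signed_center = {elt 0 0 c u | c u. u * u = 1}"

lemma elt_eq_iff [simp]: "elt a b c u = elt a' b' c' u' \<longleftrightarrow> a = a' \<and> b = b' \<and> c = c' \<and> u = u'"
  by (simp add: elt_def)

lemma signed_heisenberg_carrier:
  "carrier signed_heisenberg = {elt a b c u | a b c u. u * u = 1}"
  by (simp add: signed_heisenberg_def)

lemma elt_in_carrier [simp]: "elt a b c u \<in> carrier signed_heisenberg \<longleftrightarrow> u * u = 1"
  by (auto simp: signed_heisenberg_carrier)

lemma elt_mult [simp]:
  "elt a b c u \<otimes>\<^bsub>signed_heisenberg\<^esub> elt a' b' c' u' =
     elt (a + u * a') (b + u * b') (c + c' + a * u * b') (u * u')"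
  by (simp add: signed_heisenberg_def elt_def)

lemma elt_one [simp]: "\<one>\<^bsub>signed_heisenberg\<^esub> = elt 0 0 0 1"
  by (simp add: signed_heisenberg_def)

lemma group_signed_heisenberg: "group signed_heisenberg"
proof (rule groupI)
  fix x y z
  assume "x \<in> carrier signed_heisenberg" "y \<in> carrier signed_heisenberg"
    "z \<in> carrier signed_heisenberg"
  then obtain a b c u a' b' c' u' a'' b'' c'' u'' where
    xyz: "x = elt a b c u" "y = elt a' b' c' u'" "z = elt a'' b'' c'' u''"
    and u: "u * u = 1"
    by (auto simp: signed_heisenberg_carrier)
  have "u * (u * w) = w" for w
    using u by (simp flip: mult.assoc)
  then show "x \<otimes>\<^bsub>signed_heisenberg\<^esub> y \<otimes>\<^bsub>signed_heisenberg\<^esub> z =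
      x \<otimes>\<^bsub>signed_heisenberg\<^esub> (y \<otimes>\<^bsub>signed_heisenberg\<^esub> z)"
    by (simp add: xyz algebra_simps)
next
  fix x
  assume "x \<in> carrier signed_heisenberg"
  then obtain a b c u where x: "x = elt a b c u" and u: "u * u = 1"
    by (auto simp: signed_heisenberg_carrier)
  have "u * (u * w) = w" for w
    using u by (simp flip: mult.assoc)
  then have "elt (- (u * a)) (- (u * b)) (a * b - c) u \<otimes>\<^bsub>signed_heisenberg\<^esub> x = \<one>\<^bsub>signed_heisenberg\<^esub>"
    by (simp add: x u algebra_simps)
  then show "\<exists>y\<in>carrier signed_heisenberg. y \<otimes>\<^bsub>signed_heisenberg\<^esub> x = \<one>\<^bsub>signed_heisenberg\<^esub>"
    using u by (meson elt_in_carrier)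
next
  fix x y
  assume "x \<in> carrier signed_heisenberg" "y \<in> carrier signed_heisenberg"
  then show "x \<otimes>\<^bsub>signed_heisenberg\<^esub> y \<in> carrier signed_heisenberg"
    by (auto simp: signed_heisenberg_carrier mod_3_square_eq_1)
qed (auto simp: signed_heisenberg_carrier)

lemma elt_inv [simp]:
  assumes u: "u * u = 1"
  shows "inv\<^bsub>signed_heisenberg\<^esub> elt a b c u = elt (- (u * a)) (- (u * b)) (a * b - c) u"
proof (rule group.inv_equality[OF group_signed_heisenberg])
  have "u * (u * w) = w" for w
    using u by (simp flip: mult.assoc)
  then show "elt (- (u * a)) (- (u * b)) (a * b - c) u \<otimes>\<^bsub>signed_heisenberg\<^esub> elt a b c u
      = \<one>\<^bsub>signed_heisenberg\<^esub>"
    by (simp add: u algebra_simps)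
qed (simp_all add: u)

lemma order_signed_heisenberg: "order signed_heisenberg = 54"
proof -
  have "carrier signed_heisenberg
      = (\<lambda>(a, b, c, u). elt a b c u) ` (UNIV \<times> UNIV \<times> UNIV \<times> {1, -1})"
    by (force simp: signed_heisenberg_carrier mod_3_square_eq_1)
  moreover have "inj_on (\<lambda>(a, b, c, u). elt a b c u) A" for A
    by (auto simp: inj_on_def)
  ultimately show ?thesis
    by (simp add: order_def card_image card_cartesian_product)
qed

lemma finite_signed_heisenberg: "finite (carrier signed_heisenberg)"
  using order_signed_heisenberg by (simp add: order_def card_ge_0_finite)

lemma card_heisenberg: "card heisenberg = 27"
proof -
  have "heisenberg = range (\<lambda>(a, b, c). elt a b c 1)"
    by (auto simp: heisenberg_def image_iff)
  also have "card \<dots> = CARD(3 \<times> 3 \<times> 3)"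
    by (rule card_image) (auto simp: inj_on_def)
  finally show ?thesis
    by simp
qed

lemma card_heisenberg_center: "card heisenberg_center = 3"
proof -
  have "heisenberg_center = range (\<lambda>c. elt 0 0 c 1)"
    by (auto simp: heisenberg_center_def)
  also have "card \<dots> = CARD(3)"
    by (rule card_image) (auto simp: inj_on_def)
  finally show ?thesis
    by simp
qed

lemma heisenberg_normal: "heisenberg \<lhd> signed_heisenberg"
proof -
  interpret group signed_heisenberg
    by (rule group_signed_heisenberg)
  have "subgroup heisenberg signed_heisenberg"
    by (rule subgroupI) (auto simp: heisenberg_def)
  then show ?thesis
    by (auto simp: normal_inv_iff signed_heisenberg_carrier heisenberg_def)
qed

lemma signed_center_subgroup: "subgroup signed_center signed_heisenberg"
proof -
  interpret group signed_heisenberg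
    by (rule group_signed_heisenberg)
  show ?thesis
    by (rule subgroupI) (auto simp: signed_center_def mod_3_square_eq_1)
qed

text \<open>Commuting with the two noncentral generators \<open>(1, 0, 0)\<close> and \<open>(0, 1, 0)\<close> of \<open>Q\<close> forces
  the sign to be \<open>1\<close> and the entries \<open>a\<close> and \<open>b\<close> to vanish.\<close>

lemma centralizer_heisenberg: "centralizer signed_heisenberg heisenberg = heisenberg_center"
proof (intro equalityI subsetI)
  fix g
  assume g: "g \<in> centralizer signed_heisenberg heisenberg"
  then obtain a b c u where abc: "g = elt a b c u"
    by (auto simp: centralizer_def signed_heisenberg_carrier)
  have "g \<otimes>\<^bsub>signed_heisenberg\<^esub> elt a' b' 0 1 = elt a' b' 0 1 \<otimes>\<^bsub>signed_heisenberg\<^esub> g" for a' b'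
    using g by (auto simp: centralizer_def heisenberg_def)
  from this[of 1 0] this[of 0 1] show "g \<in> heisenberg_center"
    by (auto simp: abc heisenberg_center_def)
qed (auto simp: centralizer_def heisenberg_def heisenberg_center_def)

text \<open>Commutators only change the corner entry, so they are central; and
  \<open>(a, b, c)\<^sup>3 = (3a, 3b, 3c + 3ab)\<close> vanishes modulo 3.\<close>

lemma heisenberg_is_three_plus_one_plus_two:
  "is_three_plus_one_plus_two (signed_heisenberg\<lparr>carrier := heisenberg\<rparr>)"
proof -
  let ?Q = "signed_heisenberg\<lparr>carrier := heisenberg\<rparr>"
  interpret G: group signed_heisenberg
    by (rule group_signed_heisenberg)
  have sub: "subgroup heisenberg signed_heisenberg"
    using heisenberg_normal by (rule normal_imp_subgroup)
  interpret Q: group ?Q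
    using sub by (rule G.subgroup_imp_group)
  have inv: "inv\<^bsub>?Q\<^esub> (elt a b c 1) = elt (- a) (- b) (a * b - c) 1" for a b c
    using sub by (subst G.m_inv_consistent) (auto simp: heisenberg_def)
  have "heisenberg_center \<subseteq> heisenberg"
    by (auto simp: heisenberg_def heisenberg_center_def)
  moreover have "group_center ?Q = centralizer signed_heisenberg heisenberg \<inter> heisenberg"
    using subgroup.subset[OF sub] by (auto simp: group_center_def centralizer_def)
  ultimately have center: "group_center ?Q = heisenberg_center"
    using centralizer_heisenberg by blast
  have "subgroup heisenberg_center ?Q"
    by (rule Q.subgroupI) (auto simp: inv heisenberg_def[THEN eqset_imp_iff] heisenberg_center_def)
  then have normal: "heisenberg_center \<lhd> ?Q"
    by (auto simp: Q.normal_inv_iff inv heisenberg_def[THEN eqset_imp_iff] heisenberg_center_def)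
  have pow: "x [^]\<^bsub>?Q\<^esub> (3::nat) = \<one>\<^bsub>?Q\<^esub>" if x_in: "x \<in> carrier ?Q" for x
  proof -
    obtain a b c where x: "x = elt a b c 1"
      using x_in by (auto simp: heisenberg_def)
    show ?thesis
      by (simp add: x numeral_3_eq_3 mod_3_triple)
  qed
  have comm: "\<exists>z\<in>heisenberg_center. x \<otimes>\<^bsub>?Q\<^esub> y = z \<otimes>\<^bsub>?Q\<^esub> (y \<otimes>\<^bsub>?Q\<^esub> x)"
    if xy_in: "x \<in> carrier ?Q" "y \<in> carrier ?Q" for x y
  proof -
    obtain a b c a' b' c' where xy: "x = elt a b c 1" "y = elt a' b' c' 1"
      using xy_in by (auto simp: heisenberg_def)
    have "x \<otimes>\<^bsub>?Q\<^esub> y = elt 0 0 (a * b' - a' * b) 1 \<otimes>\<^bsub>?Q\<^esub> (y \<otimes>\<^bsub>?Q\<^esub> x)"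
      by (simp add: xy algebra_simps)
    then show ?thesis
      unfolding heisenberg_center_def by blast
  qed
  have order: "order ?Q = 27"
    using card_heisenberg by (simp add: order_def)
  have noncentral: "elt 1 0 0 1 \<in> carrier ?Q" "elt 1 0 0 1 \<notin> heisenberg_center"
    by (auto simp: heisenberg_def heisenberg_center_def)
  have prime: "prime (3::nat)"
    by simp
  have "\<exists>n. order ?Q = 3 ^ n"
    using order by (intro exI[of _ 3]) simp
  moreover have "elementary_abelian 3 (?Q Mod heisenberg_center)"
    using normal comm pow by (rule Q.elementary_abelian_Mod)
  moreover have "carrier (?Q Mod heisenberg_center) \<noteq> {\<one>\<^bsub>?Q Mod heisenberg_center\<^esub>}"
    using normal noncentral by (rule Q.Mod_nontrivial)
  ultimately have "extraspecial 3 ?Q"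
    unfolding extraspecial_def center card_heisenberg_center
    using Q.is_group prime by blast
  moreover have "carrier ?Q \<noteq> {\<one>\<^bsub>?Q\<^esub>}"
  proof
    assume "carrier ?Q = {\<one>\<^bsub>?Q\<^esub>}"
    then have "elt 1 0 0 1 = \<one>\<^bsub>?Q\<^esub>"
      using noncentral(1) by blast
    then show False
      by simp
  qed
  with prime pow have "group_exponent ?Q = 3"
    by (rule Q.group_exponent_prime)
  ultimately show ?thesis
    unfolding is_three_plus_one_plus_two_def using order by blast
qed

lemma heisenberg_sylow: "sylow_subgroup 3 signed_heisenberg heisenberg"
proof -
  have "multiplicity 3 (54::nat) = 3"
    by (rule multiplicity_eqI) simp_all
  then show ?thesis
    using normal_imp_subgroup[OF heisenberg_normal]
      card_heisenberg
    by (simp add: sylow_subgroup_def order_signed_heisenberg)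
qed

theorem mainTheorem2:
  assumes "CHAR('k::alg_closed_field) = 3"
  shows "\<exists>(G :: nat monoid) (Q :: nat set) (e :: nat \<Rightarrow> 'k) (H :: nat set).
    group G \<and> finite (carrier G) \<and>
    sylow_subgroup 3 G Q \<and> is_three_plus_one_plus_two (G\<lparr>carrier := Q\<rparr>) \<and>
    is_block (G\<lparr>carrier := centralizer G Q\<rparr>) e \<and>
    subgroup H G \<and> centralizer G Q \<subseteq> H \<and> H \<subseteq> block_normalizer G Q e \<and>
    \<not> is_block (G\<lparr>carrier := H\<rparr>) e"
proof -
  interpret G: group signed_heisenberg
    by (rule group_signed_heisenberg)
  let ?e = "\<one>\<^bsub>group_algebra signed_heisenberg\<^esub> :: nat \<Rightarrow> 'k"
  let ?C = "signed_heisenberg\<lparr>carrier := heisenberg_center\<rparr>"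
  let ?H = "signed_heisenberg\<lparr>carrier := signed_center\<rparr>"
  have "subgroup heisenberg_center signed_heisenberg"
    by (rule G.subgroupI) (auto simp: heisenberg_center_def)
  then interpret C: group ?C
    by (rule G.subgroup_imp_group)
  interpret H: group ?H
    using signed_center_subgroup by (rule G.subgroup_imp_group)
  have "is_block ?C (\<one>\<^bsub>group_algebra ?C\<^esub> :: nat \<Rightarrow> 'k)"
    using assms card_heisenberg_center by (intro C.one_is_block_order_3) (auto simp: order_def)
  then have block: "is_block ?C ?e"
    unfolding group_algebra_one_subgroup .
  have "\<not> CHAR('k) dvd 2"
    using assms by simp
  then have "(2::'k) \<noteq> 0"
    using of_nat_eq_0_iff_char_dvd[where 'a = 'k, of 2] by simp
  moreover have "finite (carrier ?H)"
    using finite_subset[OF subgroup.subset[OF signed_center_subgroup] finite_signed_heisenberg]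
    by simp
  ultimately have "\<not> is_block ?H (\<one>\<^bsub>group_algebra ?H\<^esub> :: nat \<Rightarrow> 'k)"
    by (intro H.one_not_block_if_central_involution[where t = "elt 0 0 0 (-1)"])
      (auto simp: signed_center_def)
  then have not_block: "\<not> is_block ?H ?e"
    unfolding group_algebra_one_subgroup .
  have "block_normalizer signed_heisenberg heisenberg ?e = carrier signed_heisenberg"
    by (simp only: G.block_normalizer_one finite_signed_heisenberg
        G.normalizer_normal heisenberg_normal)
  then have normalizes: "signed_center \<subseteq> block_normalizer signed_heisenberg heisenberg ?e"
    using subgroup.subset[OF signed_center_subgroup] by simp
  have centralizes: "centralizer signed_heisenberg heisenberg \<subseteq> signed_center"
    by (auto simp: centralizer_heisenberg heisenberg_center_def signed_center_def)
  show ?thesis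
    by (rule exI[of _ signed_heisenberg], rule exI[of _ heisenberg], rule exI[of _ ?e],
        rule exI[of _ signed_center],
        (intro conjI; fact group_signed_heisenberg finite_signed_heisenberg heisenberg_sylow
          heisenberg_is_three_plus_one_plus_two block[folded centralizer_heisenberg]
          signed_center_subgroup centralizes normalizes not_block))
qed

end
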